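(* Let $F$ be an ordered field with an integer part $I$ such that $\langle F,I\rangle$ is separable, and let $\alpha,\beta\in F$ be positive. If $N_{\alpha}\cap N_{\beta}=\{0\}$ and $N_{\alpha}\cup N_{\beta}=I^{\geqslant 0}$, then $\alpha,\beta$ are irrational and $\alpha^{-1}+\beta^{-1}=1$.
   Context: A subring $I$ of an ordered field $F$ is an integer part of $F$ if $I$ is discretely ordered (no $x\in I$ satisfies $0<x<1$) and for every $x\in F$ there is a (necessarily unique) $a\in I$ with $a\leqslant x<a+1$; this $a$ is denoted $\lfloor x\rfloor$. $I^{\geqslant 0}=\{x\in I: x\geqslant 0\}$. An element of $F$ is rational if it lies in the fraction field $\mathrm{Frac}(I)\subseteq F$, and irrational otherwise. For $\alpha\in F$ positive, $N_\alpha=\{\lfloor n\alpha\rfloor : n\in I^{\geqslant 0}\}$. $\langle F,I\rangle$ is called separable if for all $\alpha,\beta\in F$ with $\alpha,\beta\geqslant 1$: $N_{\alpha}\neq N_{\beta}$ if and only if $\alpha\neq\beta$. *)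

theory Defs
  imports Complex_Main
begin

text \<open>The ordered field \<^term>\<open>F\<close> is the whole type \<^typ>\<open>'a::linordered_field\<close>, with no
  Archimedean assumption; an integer part is a set of elements of this type.\<close>

definition unital_subring :: "'a::comm_ring_1 set \<Rightarrow> bool" where
  "unital_subring R \<longleftrightarrow>
     0 \<in> R \<and> 1 \<in> R \<and> (\<forall>x\<in>R. \<forall>y\<in>R. x + y \<in> R \<and> x * y \<in> R) \<and> (\<forall>x\<in>R. - x \<in> R)"

definition integer_part :: "'a::linordered_field set \<Rightarrow> bool" where
  "integer_part I \<longleftrightarrow>
     unital_subring I \<and>
     (\<forall>x\<in>I. \<not> (0 < x \<and> x < 1)) \<and>
     (\<forall>x. \<exists>a\<in>I. a \<le> x \<and> x < a + 1)"

text \<open>The library's \<^const>\<open>floor\<close> is specific to Archimedean fields and takes values in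
  \<^typ>\<open>int\<close>, so the floor is taken relative to \<^term>\<open>I\<close>. The lemma below justifies the
  definite description.\<close>

definition floor_in :: "'a::linordered_field set \<Rightarrow> 'a \<Rightarrow> 'a" where
  "floor_in I x = (THE a. a \<in> I \<and> a \<le> x \<and> x < a + 1)"

lemma integer_part_floor_unique:
  assumes "integer_part I"
  shows "\<exists>!a. a \<in> I \<and> a \<le> x \<and> x < a + 1"
proof -
  obtain a where a: "a \<in> I" "a \<le> x" "x < a + 1"
    using assms unfolding integer_part_def by blast
  have diff: "c - d \<in> I" if "c \<in> I" "d \<in> I" for c d
    using assms that unfolding integer_part_def unital_subring_def
    by (metis add_uminus_conv_diff)
  have le: "d \<le> c" if "c \<in> I" "x < c + 1" "d \<in> I" "d \<le> x" for c d
  proof (rule ccontr)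
    assume "\<not> d \<le> c"
    with that have "0 < d - c" "d - c < 1" by (auto simp: algebra_simps)
    with diff[of d c] that show False
      using assms unfolding integer_part_def by blast
  qed
  show ?thesis
    using a le by (metis antisym)
qed

text \<open>The fraction field of \<^term>\<open>I\<close> inside the ambient field.\<close>

definition frac_in :: "'a::field set \<Rightarrow> 'a set" where
  "frac_in I = {a / b | a b. a \<in> I \<and> b \<in> I \<and> b \<noteq> 0}"

definition irrational_in :: "'a::field set \<Rightarrow> 'a \<Rightarrow> bool" where
  "irrational_in I x \<longleftrightarrow> x \<notin> frac_in I"

definition nonneg_part :: "'a::linordered_field set \<Rightarrow> 'a set" where
  "nonneg_part I = {x \<in> I. 0 \<le> x}"

definition beatty :: "'a::linordered_field set \<Rightarrow> 'a \<Rightarrow> 'a set" where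
  "beatty I \<alpha> = {floor_in I (n * \<alpha>) | n. n \<in> nonneg_part I}"

definition separable :: "'a::linordered_field set \<Rightarrow> bool" where
  "separable I \<longleftrightarrow>
     (\<forall>\<alpha> \<beta>. 1 \<le> \<alpha> \<longrightarrow> 1 \<le> \<beta> \<longrightarrow> (beatty I \<alpha> \<noteq> beatty I \<beta> \<longleftrightarrow> \<alpha> \<noteq> \<beta>))"

end

theory Submission
  imports Defs
begin

text \<open>
  The proof of Rayleigh's theorem by counting the terms below a bound needs an Archimedean field,
  but the following argument does not: \<open>k > 0\<close> lies in the Beatty set of \<open>\<alpha>\<close> exactly when the interval
  from \<open>k / \<alpha>\<close> to \<open>(k + 1) / \<alpha>\<close> contains an element of \<^term>\<open>I\<close>. If
  \<open>1 / \<alpha> + 1 / \<beta> = 1\<close>, adding the bounds for \<open>\<alpha>\<close> and \<open>\<beta>\<close> puts an element of \<^term>\<open>I\<close>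
  strictly between two consecutive ones, both when \<open>k\<close> is hit twice and when it is missed twice;
  irrationality makes the bounds strict. So for an irrational \<open>\<alpha> > 1\<close> the complement of its
  Beatty set is, up to \<open>0\<close>, the Beatty set of \<open>\<alpha> / (\<alpha> - 1)\<close> (\<open>rayleigh_beatty\<close>).

  The converse follows by comparing \<open>\<beta>\<close> with this conjugate. Both slopes exceed 1, since a slope
  of at most 1 hits everything and leaves only \<open>0\<close> for the other
  (\<open>beatty_le_one\<close>, \<open>beatty_nontrivial\<close>). They are not both rational, because two
  rational slopes have a common positive multiple in \<^term>\<open>I\<close>
  (\<open>rational_beatty_meet\<close>). If, say, \<open>\<alpha>\<close> is irrational, then \<open>\<beta>\<close> and the conjugate of
  \<open>\<alpha>\<close> have the same Beatty set, hence are equal by separability, and then \<open>\<beta>\<close> is irrational too.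
\<close>

section \<open>Arithmetic in an integer part\<close>

lemma integer_part_closed:
  assumes "integer_part I"
  shows "0 \<in> I" "1 \<in> I"
    and "x \<in> I \<Longrightarrow> y \<in> I \<Longrightarrow> x + y \<in> I"
    and "x \<in> I \<Longrightarrow> y \<in> I \<Longrightarrow> x - y \<in> I"
    and "x \<in> I \<Longrightarrow> y \<in> I \<Longrightarrow> x * y \<in> I"
    and "x \<in> I \<Longrightarrow> - x \<in> I"
  using assms unfolding integer_part_def unital_subring_def
  by (blast, blast, blast, metis add_uminus_conv_diff, blast, blast)

lemma integer_part_no_between:
  assumes "integer_part I" and "x \<in> I" "y \<in> I"
  shows "\<not> (x < y \<and> y < x + 1)"
proof
  assume "x < y \<and> y < x + 1"
  then have "0 < y - x" "y - x < 1"
    by (auto simp: algebra_simps)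
  with integer_part_closed(4)[OF assms(1,3,2)] show False
    using assms(1) unfolding integer_part_def by blast
qed

lemma integer_part_floor:
  assumes "integer_part I"
  obtains a where "a \<in> I" "a \<le> x" "x < a + 1"
  using assms unfolding integer_part_def by blast

lemma integer_part_floor_nonneg:
  assumes "integer_part I" and "0 \<le> x"
  obtains a where "a \<in> I" "0 \<le> a" "a \<le> x" "x < a + 1"
proof -
  obtain a where a: "a \<in> I" "a \<le> x" "x < a + 1"
    using integer_part_floor[OF assms(1)] .
  have "\<not> a < 0"
    using integer_part_no_between[OF assms(1) a(1) integer_part_closed(1)[OF assms(1)]]
      a assms(2) by auto
  with a that show thesis by auto
qed

section \<open>Beatty sets and their slopes\<close>

lemma beatty_iff:
  assumes "integer_part I"
  shows "k \<in> beatty I \<alpha> \<longleftrightarrow> k \<in> I \<and> (\<exists>n\<in>I. 0 \<le> n \<and> k \<le> n * \<alpha> \<and> n * \<alpha> < k + 1)"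
proof -
  have "k = floor_in I x \<longleftrightarrow> k \<in> I \<and> k \<le> x \<and> x < k + 1" for x
    unfolding floor_in_def
    using theI'[OF integer_part_floor_unique[OF assms, of x]]
      the1_equality[OF integer_part_floor_unique[OF assms, of x], of k] by metis
  then show ?thesis
    unfolding beatty_def nonneg_part_def by blast
qed

lemma beatty_nonneg:
  assumes "integer_part I" and "0 < \<alpha>" and "k \<in> beatty I \<alpha>"
  shows "k \<in> nonneg_part I"
proof -
  obtain n where k: "k \<in> I" and n: "n \<in> I" "0 \<le> n" "n * \<alpha> < k + 1"
    using assms(3) beatty_iff[OF assms(1)] by blast
  have "0 \<le> n * \<alpha>" using n assms(2) by simp
  with n have "0 < k + 1" by simp
  then have "\<not> k < 0"
    using integer_part_no_between[OF assms(1) k integer_part_closed(1)[OF assms(1)]] by auto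
  with k show ?thesis by (auto simp: nonneg_part_def)
qed

lemma beatty_zero:
  assumes "integer_part I"
  shows "0 \<in> beatty I \<alpha>"
  using integer_part_closed(1)[OF assms] by (auto simp: beatty_iff[OF assms])

text \<open>Steps of length at most 1 cannot jump over a unit interval: the first multiple of \<open>\<alpha>\<close>
  reaching \<open>k\<close> has floor \<open>k\<close>.\<close>

lemma beatty_le_one:
  assumes I: "integer_part I" and "0 < \<alpha>" "\<alpha> \<le> 1"
  shows "beatty I \<alpha> = nonneg_part I"
proof (intro equalityI subsetI)
  fix k assume "k \<in> nonneg_part I"
  then have k: "k \<in> I" "0 \<le> k" by (auto simp: nonneg_part_def)
  \<comment> \<open>The ceiling of \<open>k / \<alpha>\<close> is the negated floor of \<open>- (k / \<alpha>)\<close>.\<close>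
  obtain a where a: "a \<in> I" "a \<le> - (k / \<alpha>)" "- (k / \<alpha>) < a + 1"
    using integer_part_floor[OF I] .
  have n: "k / \<alpha> \<le> - a" "- a < k / \<alpha> + 1" using a by auto
  have "0 \<le> k / \<alpha>" using k assms(2) by simp
  with n have "0 \<le> - a" by linarith
  moreover have "k \<le> - a * \<alpha>" using n(1) assms(2) by (simp add: field_simps)
  moreover have "- a * \<alpha> < k + 1"
  proof -
    have "- a * \<alpha> < (k / \<alpha> + 1) * \<alpha>"
      using n(2) assms(2) by (rule mult_strict_right_mono)
    also have "\<dots> = k + \<alpha>" using assms(2) by (simp add: field_simps)
    finally show ?thesis using assms(3) by linarith
  qed
  ultimately show "k \<in> beatty I \<alpha>"
    using k(1) integer_part_closed(6)[OF I a(1)] beatty_iff[OF I] by blast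
qed (use beatty_nonneg[OF I assms(2)] in blast)

lemma beatty_nontrivial:
  assumes I: "integer_part I" and "0 < \<alpha>"
  shows "\<exists>k\<in>beatty I \<alpha>. k \<noteq> 0"
proof -
  obtain a where a: "a \<in> I" "0 \<le> a" "1 / \<alpha> < a + 1"
    using integer_part_floor_nonneg[OF I, of "1 / \<alpha>"] assms(2) by auto
  obtain k where k: "k \<in> I" "k \<le> (a + 1) * \<alpha>" "(a + 1) * \<alpha> < k + 1"
    using integer_part_floor[OF I] .
  have "1 < (a + 1) * \<alpha>" using a(3) assms(2) by (simp add: field_simps)
  with k have "k \<noteq> 0" by auto
  moreover have "k \<in> beatty I \<alpha>"
  proof -
    have "a + 1 \<in> I" "0 \<le> a + 1"
      using a integer_part_closed(2,3)[OF I] by auto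
    with k show ?thesis using beatty_iff[OF I] by blast
  qed
  ultimately show ?thesis by blast
qed

lemma beatty_meet_trivially_gt_one:
  assumes I: "integer_part I" and "0 < \<alpha>" and "0 < \<beta>"
    and "beatty I \<alpha> \<inter> beatty I \<beta> = {0}"
  shows "1 < \<alpha>"
proof (rule ccontr)
  assume "\<not> 1 < \<alpha>"
  then have "beatty I \<alpha> = nonneg_part I" using beatty_le_one[OF I assms(2)] by simp
  then have "beatty I \<beta> \<subseteq> {0}" using beatty_nonneg[OF I assms(3)] assms(4) by blast
  with beatty_nontrivial[OF I assms(3)] show False by blast
qed

section \<open>Rational and irrational slopes\<close>

lemma frac_in_positive:
  assumes I: "integer_part I" and "0 < x" and "x \<in> frac_in I"
  obtains p q where "p \<in> I" "q \<in> I" "0 < p" "0 < q" "x = p / q"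
proof -
  obtain p q where pq: "p \<in> I" "q \<in> I" "q \<noteq> 0" "x = p / q"
    using assms(3) unfolding frac_in_def by blast
  show thesis
  proof (cases "0 < q")
    case True
    with pq assms(2) that[of p q] show thesis by (simp add: zero_less_divide_iff)
  next
    case False
    with pq have "q < 0" by simp
    with pq assms(2) that[of "- p" "- q"] integer_part_closed(6)[OF I] show thesis
      by (simp add: zero_less_divide_iff)
  qed
qed

text \<open>For \<open>\<alpha> = p / q\<close> and \<open>\<beta> = r / s\<close>, the element \<open>p * r\<close> is a multiple of both slopes.\<close>

lemma rational_beatty_meet:
  assumes I: "integer_part I" and "0 < \<alpha>" and "0 < \<beta>"
    and "\<alpha> \<in> frac_in I" and "\<beta> \<in> frac_in I"
  shows "beatty I \<alpha> \<inter> beatty I \<beta> \<noteq> {0}"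
proof -
  obtain p q where a: "p \<in> I" "q \<in> I" "0 < p" "0 < q" "\<alpha> = p / q"
    using frac_in_positive[OF I assms(2,4)] .
  obtain r s where b: "r \<in> I" "s \<in> I" "0 < r" "0 < s" "\<beta> = r / s"
    using frac_in_positive[OF I assms(3,5)] .
  have mem: "n * x \<in> beatty I x" if "n \<in> I" "0 \<le> n" "n * x \<in> I" for n x
    using that beatty_iff[OF I] by force
  have "p * r \<in> beatty I \<alpha>"
    using mem[of "q * r" \<alpha>] a b integer_part_closed(5)[OF I] by (simp add: ac_simps)
  moreover have "p * r \<in> beatty I \<beta>"
    using mem[of "p * s" \<beta>] a b integer_part_closed(5)[OF I] by (simp add: ac_simps)
  moreover have "p * r \<noteq> 0" using a b by simp
  ultimately show ?thesis by blast
qed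

lemma irrational_multiple_notin:
  assumes "irrational_in I \<alpha>" and "n \<in> I" "k \<in> I" "k \<noteq> 0"
  shows "n * \<alpha> \<noteq> k"
proof
  assume "n * \<alpha> = k"
  with assms(4) have "n \<noteq> 0" "\<alpha> = k / n" by (auto simp: field_simps)
  with assms show False unfolding irrational_in_def frac_in_def by blast
qed

lemma irrational_conjugate:
  assumes I: "integer_part I" and "irrational_in I \<alpha>"
    and "0 < \<beta>" and conj: "inverse \<alpha> + inverse \<beta> = 1"
  shows "irrational_in I \<beta>"
  unfolding irrational_in_def
proof
  assume "\<beta> \<in> frac_in I"
  then obtain p q where pq: "p \<in> I" "q \<in> I" "0 < p" "0 < q" "\<beta> = p / q"
    using frac_in_positive[OF I assms(3)] by blast
  have inv: "inverse \<alpha> = (p - q) / p" using conj pq by (simp add: field_simps)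
  have "\<alpha> = inverse (inverse \<alpha>)" by simp
  also have "\<dots> = p / (p - q)" unfolding inv by simp
  finally have \<alpha>: "\<alpha> = p / (p - q)" .
  \<comment> \<open>If \<open>p = q\<close>, this quotient has the value \<open>0 = 0 / 1\<close>.\<close>
  have "\<alpha> \<in> frac_in I"
  proof (cases "p = q")
    case True
    with \<alpha> have "\<alpha> = 0 / 1" by simp
    then show ?thesis using integer_part_closed(1,2)[OF I] unfolding frac_in_def
      using one_neq_zero by blast
  next
    case False
    then have "p - q \<noteq> 0" by simp
    then show ?thesis
      using \<alpha> pq(1) integer_part_closed(4)[OF I pq(1,2)] unfolding frac_in_def by blast
  qed
  with assms(2) show False by (simp add: irrational_in_def)
qed

section \<open>Rayleigh's theorem and its converse\<close>

text \<open>Dividing by \<open>\<alpha>\<close> turns membership of \<open>k\<close> into a condition on \<open>k / \<alpha>\<close> and \<open>(k + 1) / \<alpha>\<close>;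
  by irrationality, neither endpoint is in \<^term>\<open>I\<close>. The negation is stated through the floor
  of \<open>k / \<alpha>\<close>, so that both sides yield bounds that can be added for two slopes.\<close>

lemma irrational_beatty_bounds:
  assumes I: "integer_part I" and "0 < \<alpha>" and "irrational_in I \<alpha>"
    and k: "k \<in> I" "0 < k"
  shows "k \<in> beatty I \<alpha> \<Longrightarrow> \<exists>n\<in>I. k * inverse \<alpha> < n \<and> n < (k + 1) * inverse \<alpha>"
    and "k \<notin> beatty I \<alpha> \<Longrightarrow> \<exists>n\<in>I. n < k * inverse \<alpha> \<and> (k + 1) * inverse \<alpha> < n + 1"
proof -
  assume "k \<in> beatty I \<alpha>"
  then obtain n where n: "n \<in> I" "k \<le> n * \<alpha>" "n * \<alpha> < k + 1"
    using beatty_iff[OF I] by blast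
  moreover have "n * \<alpha> \<noteq> k" using irrational_multiple_notin[OF assms(3) n(1) k(1)] k(2) by simp
  ultimately have "k * inverse \<alpha> < n \<and> n < (k + 1) * inverse \<alpha>"
    using assms(2) by (simp add: field_simps)
  with n(1) show "\<exists>n\<in>I. k * inverse \<alpha> < n \<and> n < (k + 1) * inverse \<alpha>" by blast
next
  assume notin: "k \<notin> beatty I \<alpha>"
  obtain n where n: "n \<in> I" "0 \<le> n" "n \<le> k / \<alpha>" "k / \<alpha> < n + 1"
    using integer_part_floor_nonneg[OF I, of "k / \<alpha>"] k assms(2) by auto
  have n1: "n + 1 \<in> I" and k1: "k + 1 \<in> I"
    using n k integer_part_closed(2,3)[OF I] by auto
  have "n * \<alpha> \<noteq> k" using irrational_multiple_notin[OF assms(3) n(1) k(1)] k(2) by simp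
  moreover have "n * \<alpha> \<le> k" using n assms(2) by (simp add: field_simps)
  ultimately have low: "n * \<alpha> < k" by simp
  have "k \<le> (n + 1) * \<alpha>" using n(4) assms(2) by (simp add: field_simps)
  moreover have "0 \<le> n + 1" using n(2) by simp
  ultimately have "\<not> (n + 1) * \<alpha> < k + 1"
    using notin k(1) n1 beatty_iff[OF I] by blast
  moreover have "(n + 1) * \<alpha> \<noteq> k + 1"
    using irrational_multiple_notin[OF assms(3) n1 k1] k(2) by simp
  ultimately have "k + 1 < (n + 1) * \<alpha>" by simp
  then have "(k + 1) * inverse \<alpha> < n + 1" using assms(2) by (simp add: field_simps)
  moreover have "n < k * inverse \<alpha>" using low assms(2) by (simp add: field_simps)
  ultimately show "\<exists>n\<in>I. n < k * inverse \<alpha> \<and> (k + 1) * inverse \<alpha> < n + 1"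
    using n(1) by blast
qed

text \<open>Rayleigh's theorem. Write \<open>n\<close> and \<open>m\<close> for the elements supplied by the previous lemma.
  If both slopes hit \<open>k\<close>, adding the bounds gives \<open>k < n + m < k + 1\<close>; if both miss it, the sum
  is \<open>n + m < k < n + m + 1\<close>.\<close>

lemma rayleigh_beatty:
  assumes I: "integer_part I" and "0 < \<alpha>" and "0 < \<beta>"
    and irr: "irrational_in I \<alpha>" and conj: "inverse \<alpha> + inverse \<beta> = 1"
    and k: "k \<in> I" "0 < k"
  shows "k \<in> beatty I \<beta> \<longleftrightarrow> k \<notin> beatty I \<alpha>"
proof -
  note irr' = irrational_conjugate[OF I irr assms(3) conj]
  have split: "x = x * inverse \<alpha> + x * inverse \<beta>" for x
    using conj by (metis distrib_left mult.right_neutral)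
  note gap = integer_part_no_between[OF I]
  show ?thesis
  proof (intro iffI notI)
    assume "k \<in> beatty I \<beta>" "k \<in> beatty I \<alpha>"
    then obtain n m where nm: "n \<in> I" "m \<in> I"
      and "k * inverse \<alpha> < n" "n < (k + 1) * inverse \<alpha>"
      and "k * inverse \<beta> < m" "m < (k + 1) * inverse \<beta>"
      using irrational_beatty_bounds(1)[OF I assms(2) irr k]
        irrational_beatty_bounds(1)[OF I assms(3) irr' k] by blast
    then have "k < n + m" "n + m < k + 1"
      using split[of k] split[of "k + 1"] by linarith+
    with gap[OF k(1) integer_part_closed(3)[OF I nm]] show False by blast
  next
    assume a: "k \<notin> beatty I \<alpha>"
    show "k \<in> beatty I \<beta>"
    proof (rule ccontr)
      assume "k \<notin> beatty I \<beta>"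
      with a obtain n m where nm: "n \<in> I" "m \<in> I"
        and "n < k * inverse \<alpha>" "(k + 1) * inverse \<alpha> < n + 1"
        and "m < k * inverse \<beta>" "(k + 1) * inverse \<beta> < m + 1"
        using irrational_beatty_bounds(2)[OF I assms(2) irr k]
          irrational_beatty_bounds(2)[OF I assms(3) irr' k] by blast
      then have "n + m < k" "k < n + m + 1"
        using split[of k] split[of "k + 1"] by linarith+
      with gap[OF integer_part_closed(3)[OF I nm] k(1)] show False by blast
    qed
  qed
qed

text \<open>A partition determines the second Beatty set from the first, and Rayleigh's theorem
  exhibits the conjugate of \<open>\<alpha>\<close> as a slope with that set; separability identifies the slopes.\<close>

lemma irrational_partition_conjugate:
  assumes I: "integer_part I" and sep: "separable I" and "1 < \<alpha>" and "1 < \<beta>"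
    and irr: "irrational_in I \<alpha>"
    and int: "beatty I \<alpha> \<inter> beatty I \<beta> = {0}"
    and un: "beatty I \<alpha> \<union> beatty I \<beta> = nonneg_part I"
  shows "inverse \<alpha> + inverse \<beta> = 1"
proof -
  define \<gamma> where "\<gamma> = \<alpha> / (\<alpha> - 1)"
  have \<gamma>: "1 < \<gamma>" "inverse \<alpha> + inverse \<gamma> = 1"
    using assms(3) by (auto simp: \<gamma>_def field_simps)
  have pos: "0 < \<alpha>" "0 < \<beta>" "0 < \<gamma>" using assms(3,4) \<gamma>(1) by auto
  have "k \<in> beatty I \<gamma> \<longleftrightarrow> k \<in> beatty I \<beta>" for k
  proof (cases "k \<in> I \<and> 0 < k")
    case True
    then have "k \<in> beatty I \<gamma> \<longleftrightarrow> k \<notin> beatty I \<alpha>"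
      using rayleigh_beatty[OF I pos(1,3) irr \<gamma>(2)] by blast
    also have "\<dots> \<longleftrightarrow> k \<in> beatty I \<beta>"
      using True int un by (force simp: nonneg_part_def)
    finally show ?thesis .
  next
    case False
    then have "k \<in> beatty I x \<longleftrightarrow> k = 0" if "0 < x" for x
      using beatty_nonneg[OF I that] beatty_zero[OF I] by (force simp: nonneg_part_def)
    with pos show ?thesis by blast
  qed
  then have "beatty I \<gamma> = beatty I \<beta>" by blast
  then have "\<gamma> = \<beta>"
    using sep \<gamma>(1) assms(4) unfolding separable_def by (meson less_imp_le)
  with \<gamma>(2) show ?thesis by simp
qed

theorem lemma2p6:
  fixes I :: "'a::linordered_field set" and \<alpha> \<beta> :: 'a
  assumes "integer_part I"
    and "separable I"
    and "0 < \<alpha>" and "0 < \<beta>"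
    and "beatty I \<alpha> \<inter> beatty I \<beta> = {0}"
    and "beatty I \<alpha> \<union> beatty I \<beta> = nonneg_part I"
  shows "irrational_in I \<alpha> \<and> irrational_in I \<beta> \<and> inverse \<alpha> + inverse \<beta> = 1"
proof -
  note I = assms(1)
  have int': "beatty I \<beta> \<inter> beatty I \<alpha> = {0}"
    and un': "beatty I \<beta> \<union> beatty I \<alpha> = nonneg_part I"
    using assms(5,6) by auto
  have gt: "1 < \<alpha>" "1 < \<beta>"
    using beatty_meet_trivially_gt_one[OF I assms(3,4,5)] beatty_meet_trivially_gt_one[OF I assms(4,3) int'] .
  have "irrational_in I \<alpha> \<or> irrational_in I \<beta>"
    using rational_beatty_meet[OF I assms(3,4)] assms(5) by (auto simp: irrational_in_def)
  then show ?thesis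
  proof
    assume irr: "irrational_in I \<alpha>"
    then have conj: "inverse \<alpha> + inverse \<beta> = 1"
      using irrational_partition_conjugate[OF I assms(2) gt] assms(5,6) by blast
    with irr irrational_conjugate[OF I irr assms(4)] show ?thesis by blast
  next
    assume irr: "irrational_in I \<beta>"
    then have conj: "inverse \<beta> + inverse \<alpha> = 1"
      using irrational_partition_conjugate[OF I assms(2) gt(2,1)] int' un' by blast
    with irr irrational_conjugate[OF I irr assms(3)] show ?thesis
      by (simp add: add.commute)
  qed
qed

end
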